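(* Let $E_1,E_2,E_k$ be event sets with $E_1\cap E_2\subseteq E_k$, let $E=E_1\cup E_2\cup E_k$, and let $E_u\subseteq E$. Let $L_i\subseteq E_i^*$, $i=1,2,k$, be prefix-closed languages, let $L=L_1\|L_2\|L_k$, and let $K\subseteq E^*$ be a prefix-closed language that is conditionally decomposable with respect to $(E_{1+k},E_{2+k},E_k)$. Define $$\sup\mathrm{C}_k=\sup\mathrm{C}\big(P_k(K)\|P_k(L_1\|L_2)\|L_k,\;L_k,\;E_{k,u}\big),$$ $$\sup\mathrm{C}_{1+k}=\sup\mathrm{C}\big(P_{1+k}(K)\|L_1,\;L_1\|\sup\mathrm{C}_k,\;E_{1+k,u}\big),$$ $$\sup\mathrm{C}_{2+k}=\sup\mathrm{C}\big(P_{2+k}(K)\|L_2,\;L_2\|\sup\mathrm{C}_k,\;E_{2+k,u}\big).$$ Assume that, for $i=1,2$, the projection $P^{i+k}_k$ is a $(P^{i+k}_i)^{-1}(L_i)$-observer and is OCC for $(P^{i+k}_i)^{-1}(L_i)$. Then $$\sup\mathrm{C}_k\,\|\,\sup\mathrm{C}_{1+k}\,\|\,\sup\mathrm{C}_{2+k}=\sup\mathrm{cC}\big(K\cap L,\;L,\;(E_{1+k,u},E_{2+k,u},E_{k,u})\big).$$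
   Context: Notation. Event sets are finite alphabets. $E_{i+k}=E_i\cup E_k$; $E_{k,u}=E_u\cap E_k$; $E_{i+k,u}=E_u\cap E_{i+k}$. For $A\subseteq B$, the natural projection $B^*\to A^*$ is the monoid morphism erasing the symbols of $B\setminus A$ and fixing those of $A$. $P_k:E^*\to E_k^*$, $P_{i+k}:E^*\to E_{i+k}^*$, $P^{i+k}_k:E_{i+k}^*\to E_k^*$, $P^{i+k}_i:E_{i+k}^*\to E_i^*$ are natural projections; in the expression $P_k(L_1\|L_2)$, where $L_1\|L_2\subseteq (E_1\cup E_2)^*$, and when $E_k\not\subseteq E_1\cup E_2$, $L_1\|L_2$ is viewed as a language over $E$ via inverse projection $E^*\to(E_1\cup E_2)^*$. For languages $M_j\subseteq A_j^*$ the synchronous product is $\|_j M_j=\bigcap_j Q_j^{-1}(M_j)\subseteq(\bigcup_j A_j)^*$, with $Q_j:(\bigcup_l A_l)^*\to A_j^*$ the natural projection. $\overline M$ is the set of all prefixes of words of $M$; $M$ is prefix-closed if $M=\overline M$. Controllability. For a prefix-closed language $N$ over an event set $A$ and $A_u\subseteq A$, a language $M\subseteq A^*$ is controllable with respect to $N$ and $A_u$ if $\overline M A_u\cap N\subseteq\overline M$. $\sup\mathrm{C}(M,N,A_u)$ denotes the supremal controllable sublanguage of $M$ with respect to $N$ and $A_u$, i.e. the union of all sublanguages of $M$ that are controllable with respect to $N$ and $A_u$. Conditional decomposability: $K=P_{1+k}(K)\|P_{2+k}(K)\|P_k(K)$. Conditional controllability. A prefix-closed language $M\subseteq L$ is conditionally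 controllable with respect to $L=L_1\|L_2\|L_k$ and $(E_{1+k,u},E_{2+k,u},E_{k,u})$ if (i) $P_k(M)E_{k,u}\cap L_k\subseteq P_k(M)$; (ii.a) $P_{1+k}(M)E_{1+k,u}\cap \big(L_1\|P_k(M)\|P_k^{2+k}(L_2\|P_k(M))\big)\subseteq P_{1+k}(M)$; (ii.b) $P_{2+k}(M)E_{2+k,u}\cap \big(L_2\|P_k(M)\|P_k^{1+k}(L_1\|P_k(M))\big)\subseteq P_{2+k}(M)$. For prefix-closed $H\subseteq L$, $\sup\mathrm{cC}(H,L,(E_{1+k,u},E_{2+k,u},E_{k,u}))$ denotes the supremal conditionally controllable sublanguage of $H$, i.e. the union of all conditionally controllable (prefix-closed) sublanguages of $H$. Observer. A natural projection $P:A^*\to B^*$, $B\subseteq A$, is an $N$-observer for $N\subseteq A^*$ if for all $t\in P(N)$ and $s\in\overline N$ such that $P(s)$ is a prefix of $t$, there exists $u\in A^*$ with $su\in N$ and $P(su)=t$. OCC. A natural projection $P:A^*\to B^*$, $B\subseteq A$, is output control consistent (OCC) for $N\subseteq A^*$ if for every $s\in\overline N$ of the form $s=\sigma_1\sigma_2\cdots\sigma_\ell$ or $s=s'\sigma_0\sigma_1\cdots\sigma_\ell$, $\ell\ge1$, where $\sigma_0,\sigma_\ell\in B$ and $\sigma_i\in A\setminus B$ for $i=1,\dots,\ell-1$: if $\sigma_\ell\in E_u$, then $\sigma_i\in E_u$ for all $i=1,\dots,\ell-1$. *)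

theory Defs
  imports Main "HOL-Library.Sublist"
begin

text \<open>
  Events are elements of a type; event sets (alphabets) are sets of events, the set of words over \<open>A\<close> is
  \<^term>\<open>lists A\<close>, and a language is a set of words. Since a set of words does not determine its
  alphabet, the alphabets are passed explicitly wherever the meaning depends on them; in \<open>sync\<close>
  each language is paired with its alphabet.
\<close>

text \<open>The natural projection onto \<^term>\<open>B\<close>. Its values do not depend on the domain
  \<^term>\<open>lists A\<close>, so only the target alphabet is an argument.\<close>

definition proj :: "'e set \<Rightarrow> 'e list \<Rightarrow> 'e list" where
  "proj B w = filter (\<lambda>x. x \<in> B) w"

definition inv_proj :: "'e set \<Rightarrow> 'e set \<Rightarrow> 'e list set \<Rightarrow> 'e list set" where
  "inv_proj A B M = {w \<in> lists A. proj B w \<in> M}"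

definition sync :: "('e set \<times> 'e list set) list \<Rightarrow> 'e list set" where
  "sync Ms = {w \<in> lists (\<Union>(A, M) \<in> set Ms. A).
                \<forall>(A, M) \<in> set Ms. w \<in> inv_proj (\<Union>(A', M') \<in> set Ms. A') A M}"

definition prefix_closure :: "'e list set \<Rightarrow> 'e list set" where
  "prefix_closure M = {u. \<exists>w\<in>M. prefix u w}"

definition prefix_closed :: "'e list set \<Rightarrow> bool" where
  "prefix_closed M \<longleftrightarrow> M = prefix_closure M"

definition append_events :: "'e list set \<Rightarrow> 'e set \<Rightarrow> 'e list set" where
  "append_events M U = {s @ [a] | s a. s \<in> M \<and> a \<in> U}"

definition controllable :: "'e list set \<Rightarrow> 'e list set \<Rightarrow> 'e set \<Rightarrow> bool" where
  "controllable M N U \<longleftrightarrow> append_events (prefix_closure M) U \<inter> N \<subseteq> prefix_closure M"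

definition supC :: "'e list set \<Rightarrow> 'e list set \<Rightarrow> 'e set \<Rightarrow> 'e list set" where
  "supC M N U = \<Union>{M'. M' \<subseteq> M \<and> controllable M' N U}"

definition cond_decomposable ::
  "'e set \<Rightarrow> 'e set \<Rightarrow> 'e set \<Rightarrow> 'e list set \<Rightarrow> bool" where
  "cond_decomposable E1k E2k Ek K \<longleftrightarrow>
     K = sync [(E1k, proj E1k ` K), (E2k, proj E2k ` K), (Ek, proj Ek ` K)]"

text \<open>Conditional controllability of \<^term>\<open>M\<close> with respect to the product of \<^term>\<open>L1\<close>,
  \<^term>\<open>L2\<close>, \<^term>\<open>Lk\<close> (over \<^term>\<open>E1\<close>, \<^term>\<open>E2\<close>, \<^term>\<open>Ek\<close>) and the uncontrollable event sets
  \<^term>\<open>U1k\<close>, \<^term>\<open>U2k\<close>, \<^term>\<open>Uk\<close>. The product alone would not suffice as a parameter, since the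
  conditions mention the individual components.\<close>

definition cond_controllable ::
  "'e set \<Rightarrow> 'e set \<Rightarrow> 'e set \<Rightarrow> 'e list set \<Rightarrow> 'e list set \<Rightarrow> 'e list set \<Rightarrow>
   'e set \<Rightarrow> 'e set \<Rightarrow> 'e set \<Rightarrow> 'e list set \<Rightarrow> bool" where
  "cond_controllable E1 E2 Ek L1 L2 Lk U1k U2k Uk M \<longleftrightarrow>
     prefix_closed M \<and>
     M \<subseteq> sync [(E1, L1), (E2, L2), (Ek, Lk)] \<and>
     append_events (proj Ek ` M) Uk \<inter> Lk \<subseteq> proj Ek ` M \<and>
     append_events (proj (E1 \<union> Ek) ` M) U1k \<inter>
       sync [(E1, L1), (Ek, proj Ek ` M),
             (Ek, proj Ek ` sync [(E2, L2), (Ek, proj Ek ` M)])]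
       \<subseteq> proj (E1 \<union> Ek) ` M \<and>
     append_events (proj (E2 \<union> Ek) ` M) U2k \<inter>
       sync [(E2, L2), (Ek, proj Ek ` M),
             (Ek, proj Ek ` sync [(E1, L1), (Ek, proj Ek ` M)])]
       \<subseteq> proj (E2 \<union> Ek) ` M"

definition supcC ::
  "'e set \<Rightarrow> 'e set \<Rightarrow> 'e set \<Rightarrow> 'e list set \<Rightarrow> 'e list set \<Rightarrow> 'e list set \<Rightarrow>
   'e set \<Rightarrow> 'e set \<Rightarrow> 'e set \<Rightarrow> 'e list set \<Rightarrow> 'e list set" where
  "supcC E1 E2 Ek L1 L2 Lk U1k U2k Uk H =
     \<Union>{M. M \<subseteq> H \<and> cond_controllable E1 E2 Ek L1 L2 Lk U1k U2k Uk M}"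

definition observer :: "'e set \<Rightarrow> 'e set \<Rightarrow> 'e list set \<Rightarrow> bool" where
  "observer A B N \<longleftrightarrow>
     (\<forall>t \<in> proj B ` N. \<forall>s \<in> prefix_closure N. prefix (proj B s) t \<longrightarrow>
        (\<exists>u \<in> lists A. s @ u \<in> N \<and> proj B (s @ u) = t))"

text \<open>Output control consistency: below, \<^term>\<open>v\<close> is the block \<open>\<sigma>\<^sub>1 \<dots> \<sigma>\<^bsub>l-1\<^esub>\<close> of erased
  events and \<^term>\<open>b\<close> is \<open>\<sigma>\<^sub>l\<close>; the block starts either at the beginning of the word or right
  after an event \<^term>\<open>a\<close> (that is, \<open>\<sigma>\<^sub>0\<close>) of \<^term>\<open>B\<close>.\<close>

definition occ :: "'e set \<Rightarrow> 'e set \<Rightarrow> 'e set \<Rightarrow> 'e list set \<Rightarrow> bool" where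
  "occ Eu A B N \<longleftrightarrow>
     (\<forall>s \<in> prefix_closure N. \<forall>v \<in> lists (A - B). \<forall>b \<in> B.
        (s = v @ [b] \<or> (\<exists>s'. \<exists>a \<in> B. s = s' @ [a] @ v @ [b])) \<longrightarrow>
        b \<in> Eu \<longrightarrow> set v \<subseteq> Eu)"

end

theory Submission
  imports Defs
begin

text \<open>Let \<open>X\<close> be the left-hand side and let \<open>S\<^sub>k\<close>, \<open>S\<^sub>1\<close>, \<open>S\<^sub>2\<close> be its components. Since the
  alphabets of \<open>S\<^sub>1\<close> and \<open>S\<^sub>2\<close> share only \<open>E\<^sub>k\<close>, words of \<open>S\<^sub>1\<close> and \<open>S\<^sub>2\<close> that agree on \<open>E\<^sub>k\<close> can be glued,
  so \<open>P\<^sub>k(X)\<close> is the intersection of \<open>S\<^sub>k\<close>, \<open>P\<^sub>k(S\<^sub>1)\<close> and \<open>P\<^sub>k(S\<^sub>2)\<close>. If \<open>t \<in> P\<^sub>k(X)\<close> is extended in \<open>L\<^sub>k\<close> by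
  an uncontrollable event \<open>b\<close>, then \<open>tb \<in> S\<^sub>k\<close>, the observer property extends a preimage \<open>s \<in> S\<^sub>i\<close> of \<open>t\<close> to
  some \<open>s v b\<close> over the plant \<open>L\<^sub>i\<close>, and OCC makes \<open>v\<close> uncontrollable, so that \<open>s v b\<close> stays in \<open>S\<^sub>i\<close>.
  Conversely, for a conditionally controllable \<open>M\<close>, condition (i) turns membership in \<open>S\<^sub>k\<close> of an
  uncontrollable one-event extension into membership in \<open>P\<^sub>k(M)\<close>; hence the projections of \<open>M\<close> are
  controllable and lie below the three supremal languages.\<close>

section \<open>Projections and synchronous products\<close>

lemma proj_append [simp]: "proj B (u @ v) = proj B u @ proj B v"
  by (simp add: proj_def)

lemma proj_Nil [simp]: "proj B [] = []"
  by (simp add: proj_def)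

lemma proj_Cons [simp]: "proj B (a # v) = (if a \<in> B then a # proj B v else proj B v)"
  by (simp add: proj_def)

lemma proj_proj: "proj B (proj A w) = proj (A \<inter> B) w"
  by (induction w) auto

lemma proj_proj_subset: "B \<subseteq> A \<Longrightarrow> proj B (proj A w) = proj B w"
  by (simp add: proj_proj inf_absorb2)

lemma proj_ident: "w \<in> lists A \<Longrightarrow> A \<subseteq> B \<Longrightarrow> proj B w = w"
  by (induction w) auto

lemma proj_eq_Nil_iff: "proj B w = [] \<longleftrightarrow> set w \<inter> B = {}"
  by (auto simp: proj_def filter_empty_conv)

lemma proj_in_lists: "w \<in> lists A \<Longrightarrow> proj B w \<in> lists (A \<inter> B)"
  by (auto simp: proj_def)

lemma sync2_iff:
  "w \<in> sync [(A, M), (B, N)] \<longleftrightarrow> w \<in> lists (A \<union> B) \<and> proj A w \<in> M \<and> proj B w \<in> N"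
  by (auto simp: sync_def inv_proj_def)

lemma sync3_iff:
  "w \<in> sync [(A, M), (B, N), (C, Q)] \<longleftrightarrow>
     w \<in> lists (A \<union> B \<union> C) \<and> proj A w \<in> M \<and> proj B w \<in> N \<and> proj C w \<in> Q"
  by (auto simp: sync_def inv_proj_def)

text \<open>Interleave along \<open>u\<close>. An event of \<open>u\<close> outside \<open>B\<close>
  is simply prepended; before a shared event, the block of events of \<open>v\<close> private to
  \<open>B\<close> is emitted first, so that both words reach that event together.\<close>

lemma proj_gluing:
  assumes "u \<in> lists A" "v \<in> lists B" "proj (A \<inter> B) u = proj (A \<inter> B) v"
  shows "\<exists>w \<in> lists (A \<union> B). proj A w = u \<and> proj B w = v"
  using assms
proof (induction u arbitrary: v rule: list.induct)
  case Nil
  then have "proj (A \<inter> B) v = []" by simp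
  with Nil.prems have "proj A v = []"
    by (auto simp: proj_eq_Nil_iff)
  moreover have "proj B v = v"
    using Nil.prems by (auto intro: proj_ident)
  ultimately show ?case
    using Nil.prems by (intro bexI[of _ v]) auto
next
  case (Cons a u)
  show ?case
  proof (cases "a \<in> B")
    case False
    with Cons.prems have "proj (A \<inter> B) u = proj (A \<inter> B) v" by simp
    with Cons.IH Cons.prems obtain w where
      "w \<in> lists (A \<union> B)" "proj A w = u" "proj B w = v" by auto
    moreover have "a \<in> A" using Cons.prems by simp
    ultimately show ?thesis
      using False by (intro bexI[of _ "a # w"]) auto
  next
    case True
    with Cons.prems have "filter (\<lambda>x. x \<in> A \<inter> B) v = a # proj (A \<inter> B) u"
      by (simp add: proj_def)
    \<comment> \<open>\<open>x\<close> is the part of \<open>v\<close> before its first shared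
      event, which must be \<open>a\<close>; the induction hypothesis then merges \<open>u\<close>
      with the rest \<open>y\<close>.\<close>
    then obtain x y where xy: "v = x @ a # y" "\<forall>z\<in>set x. z \<notin> A \<inter> B"
      "proj (A \<inter> B) u = proj (A \<inter> B) y"
      unfolding filter_eq_Cons_iff proj_def by auto
    with Cons.IH[of y] Cons.prems obtain w where
      w: "w \<in> lists (A \<union> B)" "proj A w = u" "proj B w = y" by auto
    have "proj A x = []" "proj B x = x"
      using xy Cons.prems by (auto simp: proj_eq_Nil_iff intro: proj_ident)
    with w xy True Cons.prems show ?thesis
      by (intro bexI[of _ "x @ a # w"]) auto
  qed
qed

text \<open>Since \<open>B\<close> is the shared alphabet, \<open>T\<close> and \<open>S'\<close>
  constrain \<open>u\<close> only through its projection to \<open>B\<close>; gluing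
  \<open>u\<close> with a matching word of \<open>S'\<close> gives the preimage.\<close>

lemma proj_image_glued:
  assumes "A \<inter> A' = B" "S \<subseteq> lists A" "S' \<subseteq> lists A'"
  shows "proj A ` {w \<in> lists (A \<union> A'). proj B w \<in> T \<and> proj A w \<in> S \<and> proj A' w \<in> S'} =
         {u \<in> S. proj B u \<in> T \<inter> proj B ` S'}" (is "proj A ` ?X = ?R")
proof
  have "B \<subseteq> A" "B \<subseteq> A'" using assms(1) by auto
  then have *: "proj B (proj A w) = proj B w" "proj B w = proj B (proj A' w)" for w
    by (simp_all add: proj_proj_subset)
  show "proj A ` ?X \<subseteq> ?R"
  proof
    fix u assume "u \<in> proj A ` ?X"
    then obtain w where w: "u = proj A w" "w \<in> ?X" by blast
    then have "proj B u = proj B (proj A' w)" using * by metis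
    with w *(1)[of w] show "u \<in> ?R" by auto
  qed
  show "?R \<subseteq> proj A ` ?X"
  proof
    fix u assume "u \<in> ?R"
    then obtain v where uv: "u \<in> S" "proj B u \<in> T" "v \<in> S'" "proj B u = proj B v" by auto
    with proj_gluing[of u A v A'] assms obtain w where
      "w \<in> lists (A \<union> A')" "proj A w = u" "proj A' w = v" by blast
    with uv *(1)[of w] show "u \<in> proj A ` ?X"
      by (intro image_eqI[of _ _ w]) auto
  qed
qed

section \<open>Prefix-closed languages and supremal controllable sublanguages\<close>

lemma prefix_closure_superset: "M \<subseteq> prefix_closure M"
  by (auto simp: prefix_closure_def)

lemma prefix_closed_iff: "prefix_closed M \<longleftrightarrow> (\<forall>u v. u @ v \<in> M \<longrightarrow> u \<in> M)"
  using prefix_closure_superset[of M]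
  by (fastforce simp: prefix_closed_def prefix_closure_def prefix_def)

lemma prefix_closedD: "prefix_closed M \<Longrightarrow> u @ v \<in> M \<Longrightarrow> u \<in> M"
  by (auto simp: prefix_closed_iff)

lemma proj_eq_appendD: "proj B w = u @ v \<Longrightarrow> \<exists>x y. w = x @ y \<and> u = proj B x"
proof (induction w arbitrary: u)
  case (Cons a w)
  show ?case
  proof (cases "u = []")
    case True
    then show ?thesis by (intro exI[of _ "[]"] exI[of _ "a # w"]) simp
  next
    case False
    show ?thesis
    proof (cases "a \<in> B")
      case True
      with Cons.prems False obtain u' where u': "u = a # u'" "proj B w = u' @ v"
        by (cases u) auto
      with Cons.IH[of u'] obtain x y where "w = x @ y" "u' = proj B x" by blast
      with True u' show ?thesis by (intro exI[of _ "a # x"] exI[of _ y]) simp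
    next
      case notin: False
      with Cons obtain x y where "w = x @ y" "u = proj B x" by auto
      with notin show ?thesis by (intro exI[of _ "a # x"] exI[of _ y]) simp
    qed
  qed
qed simp

lemma prefix_closed_proj_image:
  assumes "prefix_closed M"
  shows "prefix_closed (proj B ` M)"
  unfolding prefix_closed_iff
proof (intro allI impI)
  fix u v assume "u @ v \<in> proj B ` M"
  then obtain w where w: "w \<in> M" "proj B w = u @ v" by auto
  then obtain x y where "w = x @ y" "u = proj B x"
    using proj_eq_appendD by blast
  with w assms show "u \<in> proj B ` M" by (auto dest: prefix_closedD)
qed

lemma prefix_closed_inv_proj: "prefix_closed M \<Longrightarrow> prefix_closed (inv_proj A B M)"
  by (auto simp: prefix_closed_iff inv_proj_def)

lemma prefix_closed_sync2:
  "prefix_closed M \<Longrightarrow> prefix_closed N \<Longrightarrow> prefix_closed (sync [(A, M), (B, N)])"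
  by (auto simp: prefix_closed_iff sync2_iff)

lemma prefix_closed_sync3:
  "prefix_closed M \<Longrightarrow> prefix_closed N \<Longrightarrow> prefix_closed Q \<Longrightarrow>
   prefix_closed (sync [(A, M), (B, N), (C, Q)])"
  by (auto simp: prefix_closed_iff sync3_iff)

lemma controllable_iff:
  assumes "prefix_closed M"
  shows "controllable M N U \<longleftrightarrow> (\<forall>s a. s \<in> M \<longrightarrow> a \<in> U \<longrightarrow> s @ [a] \<in> N \<longrightarrow> s @ [a] \<in> M)"
  using assms unfolding controllable_def append_events_def prefix_closed_def by auto

lemma supC_greatest: "M' \<subseteq> M \<Longrightarrow> controllable M' N U \<Longrightarrow> M' \<subseteq> supC M N U"
  by (auto simp: supC_def)

lemma supC_subset: "supC M N U \<subseteq> M"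
  by (auto simp: supC_def)

lemma prefix_closure_idem: "prefix_closure (prefix_closure M) = prefix_closure M"
  by (auto simp: prefix_closure_def intro: prefix_order.trans)

text \<open>Controllability mentions \<open>M'\<close> only through its prefix closure, so the
  closure of a candidate is again a candidate when \<open>M\<close> is prefix-closed.\<close>

lemma supC_prefix_closure:
  assumes "prefix_closed M" "M' \<subseteq> M" "controllable M' N U"
  shows "prefix_closure M' \<subseteq> supC M N U"
proof (rule supC_greatest)
  have "prefix_closure M' \<subseteq> prefix_closure M"
    using assms(2) by (auto simp: prefix_closure_def)
  then show "prefix_closure M' \<subseteq> M"
    using assms(1) by (simp add: prefix_closed_def)
  show "controllable (prefix_closure M') N U"
    using assms(3) by (simp add: controllable_def prefix_closure_idem)
qed

lemma prefix_closed_supC: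
  assumes "prefix_closed M"
  shows "prefix_closed (supC M N U)"
  unfolding prefix_closed_iff
proof (intro allI impI)
  fix u v assume "u @ v \<in> supC M N U"
  then obtain M' where M': "M' \<subseteq> M" "controllable M' N U" "u @ v \<in> M'"
    by (auto simp: supC_def)
  then have "u \<in> prefix_closure M'" unfolding prefix_closure_def using prefixI by blast
  with supC_prefix_closure[OF assms M'(1,2)] show "u \<in> supC M N U" by blast
qed

text \<open>Controllability of a candidate puts the extension only into the candidate's prefix
  closure, which still lies below the supremum.\<close>

lemma supC_extend:
  assumes "prefix_closed M" "s \<in> supC M N U" "a \<in> U" "s @ [a] \<in> N"
  shows "s @ [a] \<in> supC M N U"
proof -
  obtain M' where M': "M' \<subseteq> M" "controllable M' N U" "s \<in> M'"
    using assms(2) by (auto simp: supC_def)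
  then have "s @ [a] \<in> prefix_closure M'"
    using assms(3,4) prefix_closure_superset[of M']
    unfolding controllable_def append_events_def by blast
  with supC_prefix_closure[OF assms(1) M'(1,2)] show ?thesis by blast
qed

section \<open>Observers and output control consistency\<close>

text \<open>OCC speaks of erased blocks that start at the beginning of the word or right after an
  event of \<open>B\<close>, whereas \<open>v\<close> may begin inside such a block. It is completed
  to the left by the erased events that end \<open>s\<close>.\<close>

lemma occ_uncontrollable_block:
  assumes "occ Eu A B N" "s @ v @ [b] \<in> N" "N \<subseteq> lists A" "set v \<inter> B = {}" "b \<in> B" "b \<in> Eu"
  shows "set v \<subseteq> Eu"
proof -
  \<comment> \<open>Reversal cuts \<open>s\<close> into \<open>x @ y\<close> with \<open>y\<close>
    the longest suffix free of \<open>B\<close>; so \<open>x\<close> is empty or ends in an event of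
    \<open>B\<close>, the two cases of \<open>occ\<close>.\<close>
  define x where "x = rev (dropWhile (\<lambda>x. x \<notin> B) (rev s))"
  define y where "y = rev (takeWhile (\<lambda>x. x \<notin> B) (rev s))"
  have s: "s = x @ y"
    unfolding x_def y_def by (metis rev_append rev_rev_ident takeWhile_dropWhile_id)
  have y: "set y \<inter> B = {}"
    unfolding y_def by (auto dest: set_takeWhileD)
  have x: "x = [] \<or> (\<exists>x' a. x = x' @ [a] \<and> a \<in> B)"
  proof (cases "dropWhile (\<lambda>x. x \<notin> B) (rev s)")
    case (Cons a l)
    then have "a \<in> B" by (metis hd_dropWhile list.sel(1) list.distinct(1))
    with Cons show ?thesis by (simp add: x_def)
  qed (simp add: x_def)
  have "s @ v @ [b] \<in> prefix_closure N" using assms(2) prefix_closure_superset by blast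
  moreover have "y @ v \<in> lists (A - B)"
    using assms(2-4) y unfolding s by auto
  moreover have "s @ v @ [b] = (y @ v) @ [b] \<or>
      (\<exists>s'. \<exists>a \<in> B. s @ v @ [b] = s' @ [a] @ (y @ v) @ [b])"
    using x unfolding s by auto
  ultimately have "set (y @ v) \<subseteq> Eu"
    using assms(1,5,6) unfolding occ_def by blast
  then show ?thesis by simp
qed

text \<open>In the application \<open>N\<close> is the plant of one component, \<open>S\<close> its
  supremal language and \<open>T\<close> is \<open>supCk\<close>; \<open>closed\<close> is
  controllability of \<open>S\<close> relative to the words of \<open>N\<close> that project into
  \<open>T\<close>.\<close>

lemma uncontrollable_extension_lifts:
  assumes obs: "observer A B N" and occ: "occ Eu A B N"
    and N: "prefix_closed N" "N \<subseteq> lists A"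
    and T: "prefix_closed T" "T \<subseteq> proj B ` N"
    and S: "S \<subseteq> N"
    and closed: "\<And>s a. s \<in> S \<Longrightarrow> a \<in> Eu \<Longrightarrow> s @ [a] \<in> N \<Longrightarrow> proj B (s @ [a]) \<in> T \<Longrightarrow> s @ [a] \<in> S"
    and s: "s \<in> S" and b: "b \<in> B" "b \<in> Eu" and sb: "proj B s @ [b] \<in> T"
  shows "proj B s @ [b] \<in> proj B ` S"
proof -
  have "s \<in> prefix_closure N" using S s prefix_closure_superset by blast
  moreover have "proj B s @ [b] \<in> proj B ` N" using sb T by blast
  ultimately obtain u where u: "s @ u \<in> N" "proj B (s @ u) = proj B s @ [b]"
    using obs unfolding observer_def by (metis prefixI)
  \<comment> \<open>The continuation \<open>u\<close> projects to \<open>b\<close> alone, so only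
    erased events surround \<open>b\<close>; the tail \<open>v'\<close> is dropped by prefix closure
    of \<open>N\<close>.\<close>
  then have "filter (\<lambda>x. x \<in> B) u = [b]" by (simp add: proj_def)
  then obtain v v' where v: "u = v @ b # v'" "\<forall>z\<in>set v. z \<notin> B"
    unfolding filter_eq_Cons_iff by auto
  have svb: "s @ v @ [b] \<in> N"
    using N(1) u(1) v(1) prefix_closedD[of N "s @ v @ [b]" v'] by simp
  have vB: "set v \<inter> B = {}" using v(2) by auto
  have vu: "set v \<subseteq> Eu"
    by (rule occ_uncontrollable_block[OF occ svb N(2) vB b])
  \<comment> \<open>Erased events leave the projection at \<open>proj B s\<close>, which lies in
    \<open>T\<close> as a prefix of \<open>proj B s @ [b]\<close>; hence \<open>closed\<close>
    applies at every step.\<close>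
  have "s @ x \<in> S" if "s @ x \<in> N" "set x \<subseteq> Eu" "set x \<inter> B = {}" for x
    using that
  proof (induction x rule: rev_induct)
    case Nil
    then show ?case using s by simp
  next
    case (snoc a x)
    have "s @ x \<in> N" using prefix_closedD[OF N(1), of "s @ x" "[a]"] snoc.prems by simp
    then have "s @ x \<in> S" using snoc by auto
    moreover have "proj B ((s @ x) @ [a]) \<in> T"
      using snoc.prems prefix_closedD[OF T(1) sb] by (simp add: proj_eq_Nil_iff[THEN iffD2])
    ultimately show ?case using closed[of "s @ x" a] snoc.prems by simp
  qed
  moreover have "s @ v \<in> N" using prefix_closedD[OF N(1), of "s @ v" "[b]"] svb by simp
  ultimately have sv: "s @ v \<in> S" using vu vB by blast
  have e: "proj B ((s @ v) @ [b]) = proj B s @ [b]"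
    using vB b by (simp add: proj_eq_Nil_iff[THEN iffD2])
  with closed[OF sv b(2)] svb sb have "(s @ v) @ [b] \<in> S" by simp
  with e show ?thesis by (metis image_eqI)
qed

section \<open>The supremal conditionally controllable sublanguage\<close>

text \<open>The goal is relative to \<open>T\<close>, while condition (ii.a) is relative to the
  projection of \<open>M\<close> to \<open>Ek\<close>; condition (i) bridges the two because
  \<open>T\<close> lies in \<open>Lk\<close>. Exchanging the indices gives the second
  component.\<close>

lemma proj_image_controllable:
  assumes pc: "prefix_closed M"
    and M: "M \<subseteq> sync [(E1, L1), (E2, L2), (Ek, Lk)]" and T: "T \<subseteq> Lk"
    and i: "append_events (proj Ek ` M) (Eu \<inter> Ek) \<inter> Lk \<subseteq> proj Ek ` M"
    and ii: "append_events (proj (E1 \<union> Ek) ` M) (Eu \<inter> (E1 \<union> Ek)) \<inter>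
       sync [(E1, L1), (Ek, proj Ek ` M), (Ek, proj Ek ` sync [(E2, L2), (Ek, proj Ek ` M)])]
       \<subseteq> proj (E1 \<union> Ek) ` M"
  shows "controllable (proj (E1 \<union> Ek) ` M) (sync [(E1, L1), (Ek, T)]) (Eu \<inter> (E1 \<union> Ek))"
  unfolding controllable_iff[OF prefix_closed_proj_image[OF pc]]
proof (intro allI impI)
  fix s a
  assume s: "s \<in> proj (E1 \<union> Ek) ` M" and a: "a \<in> Eu \<inter> (E1 \<union> Ek)"
    and sa: "s @ [a] \<in> sync [(E1, L1), (Ek, T)]"
  have sM: "proj Ek s \<in> proj Ek ` M" using s by (auto simp: proj_proj_subset)
  \<comment> \<open>An event outside \<open>Ek\<close> does not change the projection; an event of
    \<open>Ek\<close> is covered by condition (i).\<close>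
  have PkM: "proj Ek (s @ [a]) \<in> proj Ek ` M"
  proof (cases "a \<in> Ek")
    case True
    then have "proj Ek s @ [a] \<in> Lk" using sa T by (auto simp: sync2_iff)
    with i a True sM show ?thesis by (auto simp: append_events_def)
  qed (use sM in simp)
  \<comment> \<open>The third factor of (ii.a) contains the projection of \<open>M\<close>: the
    image of \<open>m\<close> over \<open>E2 \<union> Ek\<close> is the preimage required.\<close>
  have "proj Ek m \<in> proj Ek ` sync [(E2, L2), (Ek, proj Ek ` M)]" if "m \<in> M" for m
  proof (rule image_eqI)
    show "proj Ek m = proj Ek (proj (E2 \<union> Ek) m)" by (simp add: proj_proj_subset)
    have "proj E2 m \<in> L2" "m \<in> lists (E1 \<union> E2 \<union> Ek)" using subsetD[OF M that] by (simp_all add: sync3_iff)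
    then show "proj (E2 \<union> Ek) m \<in> sync [(E2, L2), (Ek, proj Ek ` M)]"
      using that proj_in_lists[of m _ "E2 \<union> Ek"] by (auto simp: sync2_iff proj_proj_subset)
  qed
  with PkM have "proj Ek (s @ [a]) \<in> proj Ek ` sync [(E2, L2), (Ek, proj Ek ` M)]" by auto
  with PkM sa have "s @ [a] \<in> sync [(E1, L1), (Ek, proj Ek ` M),
      (Ek, proj Ek ` sync [(E2, L2), (Ek, proj Ek ` M)])]"
    by (simp add: sync2_iff sync3_iff)
  moreover have "s @ [a] \<in> append_events (proj (E1 \<union> Ek) ` M) (Eu \<inter> (E1 \<union> Ek))"
    using s a by (auto simp: append_events_def)
  ultimately show "s @ [a] \<in> proj (E1 \<union> Ek) ` M" using ii by blast
qed

theorem theorem22: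
  fixes E1 E2 Ek E Eu :: "'e set"
    and L1 L2 Lk L K supCk supC1k supC2k :: "'e list set"
  assumes "finite E1" and "finite E2" and "finite Ek"
    and "E1 \<inter> E2 \<subseteq> Ek"
    and "E = E1 \<union> E2 \<union> Ek"
    and "Eu \<subseteq> E"
    and "L1 \<subseteq> lists E1" and "prefix_closed L1"
    and "L2 \<subseteq> lists E2" and "prefix_closed L2"
    and "Lk \<subseteq> lists Ek" and "prefix_closed Lk"
    and "L = sync [(E1, L1), (E2, L2), (Ek, Lk)]"
    and "K \<subseteq> lists E" and "prefix_closed K"
    and "cond_decomposable (E1 \<union> Ek) (E2 \<union> Ek) Ek K"
    and "supCk = supC
           (sync [(Ek, proj Ek ` K),
                  (Ek, proj Ek ` inv_proj E (E1 \<union> E2) (sync [(E1, L1), (E2, L2)])),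
                  (Ek, Lk)])
           Lk (Eu \<inter> Ek)"
    and "supC1k = supC
           (sync [(E1 \<union> Ek, proj (E1 \<union> Ek) ` K), (E1, L1)])
           (sync [(E1, L1), (Ek, supCk)]) (Eu \<inter> (E1 \<union> Ek))"
    and "supC2k = supC
           (sync [(E2 \<union> Ek, proj (E2 \<union> Ek) ` K), (E2, L2)])
           (sync [(E2, L2), (Ek, supCk)]) (Eu \<inter> (E2 \<union> Ek))"
    and "observer (E1 \<union> Ek) Ek (inv_proj (E1 \<union> Ek) E1 L1)"
    and "occ Eu (E1 \<union> Ek) Ek (inv_proj (E1 \<union> Ek) E1 L1)"
    and "observer (E2 \<union> Ek) Ek (inv_proj (E2 \<union> Ek) E2 L2)"
    and "occ Eu (E2 \<union> Ek) Ek (inv_proj (E2 \<union> Ek) E2 L2)"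
  shows "sync [(Ek, supCk), (E1 \<union> Ek, supC1k), (E2 \<union> Ek, supC2k)] =
         supcC E1 E2 Ek L1 L2 Lk
           (Eu \<inter> (E1 \<union> Ek)) (Eu \<inter> (E2 \<union> Ek)) (Eu \<inter> Ek) (K \<inter> L)"
proof -

  \<comment> \<open>Bounds and closure properties of the three supremal languages\<close>
  note Ek_int = \<open>E1 \<inter> E2 \<subseteq> Ek\<close>
  note pcL = \<open>prefix_closed L1\<close> \<open>prefix_closed L2\<close> \<open>prefix_closed Lk\<close>
  note pcPK = prefix_closed_proj_image[OF \<open>prefix_closed K\<close>]
  let ?A1 = "E1 \<union> Ek" and ?A2 = "E2 \<union> Ek"
  let ?U1 = "Eu \<inter> ?A1" and ?U2 = "Eu \<inter> ?A2" and ?Uk = "Eu \<inter> Ek"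
  let ?N1 = "inv_proj ?A1 E1 L1" and ?N2 = "inv_proj ?A2 E2 L2"
  let ?R = "proj Ek ` inv_proj E (E1 \<union> E2) (sync [(E1, L1), (E2, L2)])"
  let ?Hk = "sync [(Ek, proj Ek ` K), (Ek, ?R), (Ek, Lk)]"
  let ?H1 = "sync [(?A1, proj ?A1 ` K), (E1, L1)]"
  let ?H2 = "sync [(?A2, proj ?A2 ` K), (E2, L2)]"
  have Sk: "supCk = supC ?Hk Lk ?Uk"
    and S1: "supC1k = supC ?H1 (sync [(E1, L1), (Ek, supCk)]) ?U1"
    and S2: "supC2k = supC ?H2 (sync [(E2, L2), (Ek, supCk)]) ?U2"
    by fact+
  have pcHk: "prefix_closed ?Hk"
    by (intro prefix_closed_sync3 prefix_closed_proj_image prefix_closed_inv_proj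
        prefix_closed_sync2 pcL \<open>prefix_closed K\<close>)
  have pcH1: "prefix_closed ?H1" and pcH2: "prefix_closed ?H2"
    by (intro prefix_closed_sync2 pcPK pcL)+
  have pcSk: "prefix_closed supCk" and pcS1: "prefix_closed supC1k" and pcS2: "prefix_closed supC2k"
    unfolding Sk S1 S2 by (intro prefix_closed_supC pcHk pcH1 pcH2)+
  have subSk: "supCk \<subseteq> ?Hk" and subS1: "supC1k \<subseteq> ?H1" and subS2: "supC2k \<subseteq> ?H2"
    unfolding Sk S1 S2 by (rule supC_subset)+
  have SkEk: "proj Ek w = w" if "w \<in> supCk" for w
    using subsetD[OF subSk that] by (intro proj_ident[of w Ek]) (simp_all add: sync3_iff)
  have S1A: "supC1k \<subseteq> lists ?A1" and S2A: "supC2k \<subseteq> lists ?A2"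
  proof -
    show "supC1k \<subseteq> lists ?A1" using subS1 unfolding subset_iff sync2_iff by (simp add: Un_commute Un_left_commute)
    show "supC2k \<subseteq> lists ?A2" using subS2 unfolding subset_iff sync2_iff by (simp add: Un_commute Un_left_commute)
  qed
  have SkLk: "supCk \<subseteq> Lk" and SkK: "supCk \<subseteq> proj Ek ` K" and SkR: "supCk \<subseteq> ?R"
  proof -
    have "w \<in> Lk \<and> w \<in> proj Ek ` K \<and> w \<in> ?R" if "w \<in> supCk" for w
      using subsetD[OF subSk that] unfolding sync3_iff SkEk[OF that] by blast
    then show "supCk \<subseteq> Lk" "supCk \<subseteq> proj Ek ` K" "supCk \<subseteq> ?R" by blast+
  qed
  have S1K: "supC1k \<subseteq> proj ?A1 ` K" and S2K: "supC2k \<subseteq> proj ?A2 ` K"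
  proof -
    show "supC1k \<subseteq> proj ?A1 ` K"
    proof
      fix w assume w: "w \<in> supC1k"
      then have "proj ?A1 w = w" using S1A by (intro proj_ident[of w ?A1]) auto
      with subsetD[OF subS1 w] show "w \<in> proj ?A1 ` K" by (simp add: sync2_iff)
    qed
    show "supC2k \<subseteq> proj ?A2 ` K"
    proof
      fix w assume w: "w \<in> supC2k"
      then have "proj ?A2 w = w" using S2A by (intro proj_ident[of w ?A2]) auto
      with subsetD[OF subS2 w] show "w \<in> proj ?A2 ` K" by (simp add: sync2_iff)
    qed
  qed
  have S1N: "supC1k \<subseteq> ?N1" and S2N: "supC2k \<subseteq> ?N2"
    using subS1 subS2 S1A S2A by (auto simp: sync2_iff inv_proj_def)
  \<comment> \<open>This is the hypothesis \<open>closed\<close> of the lifting lemma with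
    \<open>T\<close> taken as \<open>supCk\<close>; that \<open>a\<close> belongs to
    \<open>?A1\<close> follows from \<open>s @ [a] \<in> ?N1\<close>.\<close>
  have ext1: "s @ [a] \<in> supC1k"
    if "s \<in> supC1k" "a \<in> Eu" "s @ [a] \<in> ?N1" "proj Ek (s @ [a]) \<in> supCk" for s a
    using supC_extend[OF pcH1 that(1)[unfolded S1]] that(2-4)
    unfolding S1[symmetric] by (auto simp: sync2_iff inv_proj_def)
  have ext2: "s @ [a] \<in> supC2k"
    if "s \<in> supC2k" "a \<in> Eu" "s @ [a] \<in> ?N2" "proj Ek (s @ [a]) \<in> supCk" for s a
    using supC_extend[OF pcH2 that(1)[unfolded S2]] that(2-4)
    unfolding S2[symmetric] by (auto simp: sync2_iff inv_proj_def)

  \<comment> \<open>The product \<open>X\<close> and its projections\<close>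
  define X where "X = sync [(Ek, supCk), (?A1, supC1k), (?A2, supC2k)]"
  have X_iff: "w \<in> X \<longleftrightarrow> w \<in> lists E \<and> proj Ek w \<in> supCk \<and> proj ?A1 w \<in> supC1k \<and> proj ?A2 w \<in> supC2k"
    for w
    using \<open>E = E1 \<union> E2 \<union> Ek\<close> by (auto simp: X_def sync3_iff)
  have X1: "X = {w \<in> lists (?A1 \<union> ?A2). proj Ek w \<in> supCk \<and> proj ?A1 w \<in> supC1k \<and> proj ?A2 w \<in> supC2k}"
    and X2: "X = {w \<in> lists (?A2 \<union> ?A1). proj Ek w \<in> supCk \<and> proj ?A2 w \<in> supC2k \<and> proj ?A1 w \<in> supC1k}"
    using \<open>E = E1 \<union> E2 \<union> Ek\<close> by (auto simp: X_iff)
  have int12: "?A1 \<inter> ?A2 = Ek" and int21: "?A2 \<inter> ?A1 = Ek" using Ek_int by auto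
  have PX1: "proj ?A1 ` X = {u \<in> supC1k. proj Ek u \<in> supCk \<inter> proj Ek ` supC2k}"
    unfolding X1 by (rule proj_image_glued[OF int12 S1A S2A])
  have PX2: "proj ?A2 ` X = {u \<in> supC2k. proj Ek u \<in> supCk \<inter> proj Ek ` supC1k}"
    unfolding X2 by (rule proj_image_glued[OF int21 S2A S1A])
  \<comment> \<open>The projection to \<open>Ek\<close> factors through \<open>?A1\<close>, where
    the image of \<open>X\<close> is already known.\<close>
  have "proj Ek ` X = proj Ek ` proj ?A1 ` X"
    by (simp add: image_image proj_proj_subset)
  also have "\<dots> = supCk \<inter> proj Ek ` supC1k \<inter> proj Ek ` supC2k"
    unfolding PX1 by (auto intro!: rev_image_eqI)
  finally have PXk: "proj Ek ` X = supCk \<inter> proj Ek ` supC1k \<inter> proj Ek ` supC2k" .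

  \<comment> \<open>Lifting uncontrollable extensions to the components\<close>
  have RN1: "?R \<subseteq> proj Ek ` ?N1" and RN2: "?R \<subseteq> proj Ek ` ?N2"
  proof -
    \<comment> \<open>With \<open>SkR\<close> this places \<open>supCk\<close> inside the projected
      plant of each component, as the lifting lemma demands of \<open>T\<close>; \<open>F\<close>
      and \<open>M\<close> cover both indices.\<close>
    have *: "?R \<subseteq> proj Ek ` inv_proj (F \<union> Ek) F M"
      if FM: "F = E1 \<and> M = L1 \<or> F = E2 \<and> M = L2" for F M
    proof
      fix t assume "t \<in> ?R"
      then obtain w where w: "t = proj Ek w" "proj F w \<in> M"
        using FM by (auto simp: inv_proj_def sync2_iff proj_proj_subset)
      have "proj (F \<union> Ek) w \<in> inv_proj (F \<union> Ek) F M"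
        using w(2) by (auto simp: inv_proj_def proj_proj_subset) (simp add: proj_def)
      moreover have "t = proj Ek (proj (F \<union> Ek) w)" using w(1) by (simp add: proj_proj_subset)
      ultimately show "t \<in> proj Ek ` inv_proj (F \<union> Ek) F M" by blast
    qed
    show "?R \<subseteq> proj Ek ` ?N1" "?R \<subseteq> proj Ek ` ?N2" by (rule *; simp)+
  qed
  have pcN: "prefix_closed ?N1" "prefix_closed ?N2"
    by (intro prefix_closed_inv_proj pcL)+
  have NA: "?N1 \<subseteq> lists ?A1" "?N2 \<subseteq> lists ?A2" by (auto simp: inv_proj_def)
  have lift1: "t @ [b] \<in> proj Ek ` supC1k"
    if "t \<in> proj Ek ` supC1k" "b \<in> ?Uk" "t @ [b] \<in> supCk" for t b
  proof -
    from that(1) obtain s where s: "s \<in> supC1k" "t = proj Ek s" by blast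
    have "b \<in> Ek" "b \<in> Eu" using that(2) by auto
    with uncontrollable_extension_lifts[OF
        \<open>observer ?A1 Ek ?N1\<close> \<open>occ Eu ?A1 Ek ?N1\<close> pcN(1) NA(1) pcSk
        subset_trans[OF SkR RN1] S1N ext1 s(1)] that(3)
    show ?thesis unfolding s(2) by blast
  qed
  have lift2: "t @ [b] \<in> proj Ek ` supC2k"
    if "t \<in> proj Ek ` supC2k" "b \<in> ?Uk" "t @ [b] \<in> supCk" for t b
  proof -
    from that(1) obtain s where s: "s \<in> supC2k" "t = proj Ek s" by blast
    have "b \<in> Ek" "b \<in> Eu" using that(2) by auto
    with uncontrollable_extension_lifts[OF
        \<open>observer ?A2 Ek ?N2\<close> \<open>occ Eu ?A2 Ek ?N2\<close> pcN(2) NA(2) pcSk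
        subset_trans[OF SkR RN2] S2N ext2 s(1)] that(3)
    show ?thesis unfolding s(2) by blast
  qed

  \<comment> \<open>\<open>X\<close> is a conditionally controllable sublanguage of
    \<open>K \<inter> L\<close>\<close>
  have XL: "X \<subseteq> L"
  proof
    fix w assume "w \<in> X"
    then have "w \<in> lists E" "proj Ek w \<in> Lk" "proj E1 (proj ?A1 w) \<in> L1" "proj E2 (proj ?A2 w) \<in> L2"
      using SkLk S1N S2N by (auto simp: X_iff inv_proj_def)
    then show "w \<in> L"
      using \<open>E = E1 \<union> E2 \<union> Ek\<close> \<open>L = sync [(E1, L1), (E2, L2), (Ek, Lk)]\<close>
      by (simp add: sync3_iff proj_proj_subset)
  qed
  \<comment> \<open>Each factor lies in the matching projection of \<open>K\<close>, and conditional
    decomposability reassembles these into \<open>K\<close>.\<close>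
  have XK: "X \<subseteq> K"
  proof
    fix w assume "w \<in> X"
    then have w: "w \<in> lists E" "proj Ek w \<in> proj Ek ` K" "proj ?A1 w \<in> proj ?A1 ` K"
      "proj ?A2 w \<in> proj ?A2 ` K"
      using SkK S1K S2K by (auto simp: X_iff)
    have "?A1 \<union> ?A2 \<union> Ek = E" using \<open>E = E1 \<union> E2 \<union> Ek\<close> by auto
    with w have "w \<in> sync [(?A1, proj ?A1 ` K), (?A2, proj ?A2 ` K), (Ek, proj Ek ` K)]"
      by (simp add: sync3_iff)
    with \<open>cond_decomposable ?A1 ?A2 Ek K\<close> show "w \<in> K"
      unfolding cond_decomposable_def by blast
  qed
  have "cond_controllable E1 E2 Ek L1 L2 Lk ?U1 ?U2 ?Uk X"
    unfolding cond_controllable_def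
  proof (intro conjI)
    show "prefix_closed X"
      unfolding X_def by (intro prefix_closed_sync3 pcSk pcS1 pcS2)
    show "X \<subseteq> sync [(E1, L1), (E2, L2), (Ek, Lk)]"
      using XL \<open>L = sync [(E1, L1), (E2, L2), (Ek, Lk)]\<close> by simp
    \<comment> \<open>Controllability of \<open>supCk\<close> with respect to \<open>Lk\<close>
      gives the first member of the intersection \<open>PXk\<close>; the two lifting facts give the
      others.\<close>
    show "append_events (proj Ek ` X) ?Uk \<inter> Lk \<subseteq> proj Ek ` X"
    proof
      fix x assume "x \<in> append_events (proj Ek ` X) ?Uk \<inter> Lk"
      then obtain t b where x: "x = t @ [b]" "t \<in> proj Ek ` X" "b \<in> ?Uk" "t @ [b] \<in> Lk"
        by (auto simp: append_events_def)
      then have "t @ [b] \<in> supCk"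
        using supC_extend[OF pcHk] PXk unfolding Sk by blast
      with x show "x \<in> proj Ek ` X"
        using lift1 lift2 unfolding PXk by blast
    qed
    show "append_events (proj ?A1 ` X) ?U1 \<inter>
       sync [(E1, L1), (Ek, proj Ek ` X), (Ek, proj Ek ` sync [(E2, L2), (Ek, proj Ek ` X)])]
       \<subseteq> proj ?A1 ` X" (is "?lhs \<subseteq> _")
    proof
      fix x assume "x \<in> ?lhs"
      then obtain s a where x: "x = s @ [a]" "s \<in> proj ?A1 ` X" "a \<in> Eu"
        and sa: "s @ [a] \<in> sync [(E1, L1), (Ek, proj Ek ` X),
          (Ek, proj Ek ` sync [(E2, L2), (Ek, proj Ek ` X)])]"
        unfolding append_events_def by blast
      \<comment> \<open>By \<open>PXk\<close> this gives both membership in \<open>supCk\<close>,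
        needed for \<open>ext1\<close>, and a partner in \<open>supC2k\<close>, needed for
        \<open>PX1\<close>.\<close>
      from sa have "proj Ek (s @ [a]) \<in> proj Ek ` X" unfolding sync3_iff by blast
      moreover from sa have "s @ [a] \<in> ?N1"
        unfolding sync3_iff inv_proj_def by (simp add: Un_assoc)
      moreover have "s \<in> supC1k" using x(2) unfolding PX1 by blast
      ultimately show "x \<in> proj ?A1 ` X" using ext1[of s a] x(1,3) unfolding PX1 PXk by blast
    qed
    show "append_events (proj ?A2 ` X) ?U2 \<inter>
       sync [(E2, L2), (Ek, proj Ek ` X), (Ek, proj Ek ` sync [(E1, L1), (Ek, proj Ek ` X)])]
       \<subseteq> proj ?A2 ` X" (is "?lhs \<subseteq> _")
    proof
      fix x assume "x \<in> ?lhs"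
      then obtain s a where x: "x = s @ [a]" "s \<in> proj ?A2 ` X" "a \<in> Eu"
        and sa: "s @ [a] \<in> sync [(E2, L2), (Ek, proj Ek ` X),
          (Ek, proj Ek ` sync [(E1, L1), (Ek, proj Ek ` X)])]"
        unfolding append_events_def by blast
      from sa have "proj Ek (s @ [a]) \<in> proj Ek ` X" unfolding sync3_iff by blast
      moreover from sa have "s @ [a] \<in> ?N2"
        unfolding sync3_iff inv_proj_def by (simp add: Un_assoc)
      moreover have "s \<in> supC2k" using x(2) unfolding PX2 by blast
      ultimately show "x \<in> proj ?A2 ` X" using ext2[of s a] x(1,3) unfolding PX2 PXk by blast
    qed
  qed
  with XL XK have le: "X \<subseteq> supcC E1 E2 Ek L1 L2 Lk ?U1 ?U2 ?Uk (K \<inter> L)"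
    unfolding supcC_def by blast

  \<comment> \<open>Every conditionally controllable sublanguage lies below \<open>X\<close>\<close>
  have ge: "M \<subseteq> X" if MKL: "M \<subseteq> K \<inter> L"
    and cc: "cond_controllable E1 E2 Ek L1 L2 Lk ?U1 ?U2 ?Uk M" for M
  proof -
    have pcM: "prefix_closed M" and M12: "M \<subseteq> sync [(E1, L1), (E2, L2), (Ek, Lk)]"
      and i: "append_events (proj Ek ` M) ?Uk \<inter> Lk \<subseteq> proj Ek ` M"
      and iia: "append_events (proj ?A1 ` M) ?U1 \<inter>
       sync [(E1, L1), (Ek, proj Ek ` M), (Ek, proj Ek ` sync [(E2, L2), (Ek, proj Ek ` M)])]
       \<subseteq> proj ?A1 ` M"
      and iib: "append_events (proj ?A2 ` M) ?U2 \<inter>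
       sync [(E2, L2), (Ek, proj Ek ` M), (Ek, proj Ek ` sync [(E1, L1), (Ek, proj Ek ` M)])]
       \<subseteq> proj ?A2 ` M"
      using cc unfolding cond_controllable_def by blast+
    have M21: "M \<subseteq> sync [(E2, L2), (E1, L1), (Ek, Lk)]"
      using M12 unfolding subset_iff sync3_iff by (simp add: Un_ac)
    have m: "m \<in> lists E" "m \<in> K" "proj E1 m \<in> L1" "proj E2 m \<in> L2" "proj Ek m \<in> Lk"
      if "m \<in> M" for m
      using subsetD[OF M12 that] subsetD[OF MKL that] \<open>E = E1 \<union> E2 \<union> Ek\<close>
      by (simp_all add: sync3_iff)
    have PM: "proj B m \<in> lists B" for B and m :: "'e list" by (auto simp: proj_def)
    have "proj Ek ` M \<subseteq> ?Hk"
    proof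
      fix t assume "t \<in> proj Ek ` M"
      then obtain w where w: "t = proj Ek w" "w \<in> M" by blast
      then have "proj (E1 \<union> E2) w \<in> sync [(E1, L1), (E2, L2)]"
        using m PM by (auto simp: sync2_iff proj_proj_subset)
      then have "t \<in> ?R" using w m unfolding inv_proj_def by blast
      with w m PM[of Ek w] show "t \<in> ?Hk" by (auto simp: sync3_iff proj_proj_subset)
    qed
    \<comment> \<open>The projection is prefix-closed, so with closures rewritten away
      controllability is exactly condition (i).\<close>
    moreover have "controllable (proj Ek ` M) Lk ?Uk"
      unfolding controllable_def prefix_closed_proj_image[OF pcM, unfolded prefix_closed_def, symmetric]
      by (rule i)
    ultimately have Mk: "proj Ek ` M \<subseteq> supCk" unfolding Sk by (rule supC_greatest)
    have sub: "proj ?A1 ` M \<subseteq> ?H1" "proj ?A2 ` M \<subseteq> ?H2"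
      using m by (auto simp: sync2_iff proj_proj_subset) (auto simp: proj_def)
    have "proj ?A1 ` M \<subseteq> supC1k"
      unfolding S1 by (rule supC_greatest[OF sub(1) proj_image_controllable[OF pcM M12 SkLk i iia]])
    moreover have "proj ?A2 ` M \<subseteq> supC2k"
      unfolding S2 by (rule supC_greatest[OF sub(2) proj_image_controllable[OF pcM M21 SkLk i iib]])
    ultimately show "M \<subseteq> X"
      using Mk m(1) unfolding subset_iff X_iff by blast
  qed
  have "supcC E1 E2 Ek L1 L2 Lk ?U1 ?U2 ?Uk (K \<inter> L) \<subseteq> X"
    unfolding supcC_def using ge by blast
  with le show ?thesis unfolding X_def by (rule subset_antisym)
qed

end
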